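(* Let $\mathbb K$ be a field of characteristic $0$. Let $g\in\mathbb K[X][Y]$ be an irreducible polynomial of total degree $d$ with $\partial g/\partial Y\neq0$, and let $\phi\in\overline{\mathbb K}\{\{X\}\}$ be a root of $g$ (as a polynomial in $Y$) of valuation $v$. Let $f=\sum_{j=1}^\ell c_jX^{\alpha_j}Y^{\beta_j}$ with all $c_j\neq0$ and pairwise distinct exponent pairs $(\alpha_j,\beta_j)$, and suppose that the family $(X^{\alpha_j}\phi^{\beta_j})_{1\le j\le\ell}$ is linearly independent over $\overline{\mathbb K}$. Then \[\mathrm{val}\bigl(f(X,\phi(X))\bigr)\le\min_{1\le j\le\ell}(\alpha_j+v\beta_j)+\bigl(2d(4d+1)-v\bigr)\binom{\ell}{2}.\]
   Context: $\overline{\mathbb K}\{\{X\}\}$ denotes the field of Puiseux series over the algebraic closure $\overline{\mathbb K}$: formal sums $\phi=\sum_{t\ge t_0}f_tX^{t/e}$ with $f_t\in\overline{\mathbb K}$, $f_{t_0}\neq0$, $t_0\in\mathbb Z$, $e\in\mathbb N_{>0}$; its valuation is $\mathrm{val}(\phi)=t_0/e$ (and $\mathrm{val}(0)=+\infty$). *)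

theory Defs
  imports "HOL-Algebra.Algebraic_Closure_Type" "HOL-Library.Extended_Real"
begin

text \<open>Puiseux series over a field 'b are represented by their coefficient
  function q \<mapsto> coefficient of X^q (q rational).  The Puiseux condition:
  the support lies in (1/e) Z for some e > 0 and is bounded below.\<close>

type_synonym 'b pseries = "rat \<Rightarrow> 'b"

definition is_puiseux :: "'b::zero pseries \<Rightarrow> bool" where
  "is_puiseux \<phi> \<longleftrightarrow> (\<exists>e::nat. e > 0 \<and> (\<exists>t0::int.
      \<forall>q. \<phi> q \<noteq> 0 \<longrightarrow> (\<exists>t::int. t \<ge> t0 \<and> q = of_int t / of_nat e)))"

text \<open>Valuation (val 0 = +infinity).  For a nonzero Puiseux series the
  infimum is attained and equals t0/e.\<close>
definition ps_val :: "'b::zero pseries \<Rightarrow> ereal" where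
  "ps_val \<phi> = (INF q \<in> {q. \<phi> q \<noteq> 0}. ereal (real_of_rat q))"

text \<open>Ring operations (the sum in the product is finite for Puiseux series).\<close>
definition ps_const :: "'b::zero \<Rightarrow> 'b pseries" where
  "ps_const c = (\<lambda>q. if q = 0 then c else 0)"

definition ps_add :: "'b::plus pseries \<Rightarrow> 'b pseries \<Rightarrow> 'b pseries" where
  "ps_add \<phi> \<psi> = (\<lambda>q. \<phi> q + \<psi> q)"

definition ps_mult :: "'b::{comm_ring_1} pseries \<Rightarrow> 'b pseries \<Rightarrow> 'b pseries" where
  "ps_mult \<phi> \<psi> = (\<lambda>q. \<Sum>s \<in> {s. \<phi> s \<noteq> 0 \<and> \<psi> (q - s) \<noteq> 0}. \<phi> s * \<psi> (q - s))"

primrec ps_pow :: "'b::comm_ring_1 pseries \<Rightarrow> nat \<Rightarrow> 'b pseries" where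
  "ps_pow \<phi> 0 = ps_const 1"
| "ps_pow \<phi> (Suc n) = ps_mult \<phi> (ps_pow \<phi> n)"

definition ps_Xpow :: "nat \<Rightarrow> 'b::{zero,one} pseries" where
  "ps_Xpow n = (\<lambda>q. if q = of_nat n then 1 else 0)"

definition ps_of_poly :: "'a::field poly \<Rightarrow> 'a alg_closure pseries" where
  "ps_of_poly p = (\<lambda>q. if \<exists>n::nat. q = of_nat n then to_ac (coeff p (nat \<lfloor>q\<rfloor>)) else 0)"

text \<open>g(X, \<phi>) for g in K[X][Y] (outer polynomial variable = Y).\<close>
definition ps_eval :: "'a::field poly poly \<Rightarrow> 'a alg_closure pseries \<Rightarrow> 'a alg_closure pseries" where
  "ps_eval g \<phi> = (\<lambda>q. \<Sum>i\<le>degree g. ps_mult (ps_of_poly (coeff g i)) (ps_pow \<phi> i) q)"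

definition total_degree :: "'a::zero poly poly \<Rightarrow> nat" where
  "total_degree g = Max ({0} \<union> {i + degree (coeff g i) | i. coeff g i \<noteq> 0})"

definition ps_lin_indep :: "nat \<Rightarrow> (nat \<Rightarrow> 'b::field pseries) \<Rightarrow> bool" where
  "ps_lin_indep l F \<longleftrightarrow> (\<forall>a :: nat \<Rightarrow> 'b.
      (\<forall>q. (\<Sum>j<l. a j * F j q) = 0) \<longrightarrow> (\<forall>j<l. a j = 0))"

end

theory Submission
  imports Defs "Jordan_Normal_Form.Char_Poly"
    "HOL-Computational_Algebra.Formal_Laurent_Series"
    "HOL-Computational_Algebra.Polynomial_Factorial"
begin

text \<open>
  With \<open>T = X\<^sup>1\<^sup>/\<^sup>e\<close> the root becomes a Laurent series \<open>\<Phi>\<close> in \<open>T\<close>. The derivation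
  \<open>D = \<Phi> g\<^sub>Y(X, \<Phi>) \<cdot> T d/dT\<close> maps polynomials in \<open>X, \<Phi>\<close> to such polynomials, raises degrees by at
  most \<open>d\<close>, and lowers valuations by at most \<open>- val (\<Phi> g\<^sub>Y(X, \<Phi>))\<close>. For monomials \<open>f\<^sub>j\<close> in \<open>X\<close> and
  \<open>\<Phi>\<close> one has \<open>D\<^sup>i f\<^sub>j = f\<^sub>j Q\<^sub>i\<^sub>j(X, \<Phi>)\<close>, so their Wronskian is \<open>\<Prod> f\<^sub>j\<close> times \<open>Q(X, \<Phi>)\<close> with
  \<open>Q = det Q\<^sub>i\<^sub>j\<close> of degree at most \<open>d (l choose 2)\<close> in each variable, and it does not vanish because the
  \<open>f\<^sub>j\<close> are independent over the constants. Cramer's rule expresses \<open>c\<^sub>k f\<^sub>k Q(X, \<Phi>)\<close> as the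
  determinant with column \<open>k\<close> replaced by the derivatives of \<open>f\<close>, which bounds \<open>val f\<close> by
  \<open>val f\<^sub>k + val Q(X, \<Phi>) - (l choose 2) val (\<Phi> g\<^sub>Y(X, \<Phi>))\<close>. Eliminating \<open>Y\<close> from \<open>g\<close> and \<open>Q\<close> gives a
  nonzero polynomial \<open>R(X) = B(X, \<Phi>) Q(X, \<Phi>)\<close> of bounded degree, hence a bound for \<open>val Q(X, \<Phi>)\<close>.
\<close>

subsection \<open>Determinants of matrices over a filtered ring\<close>

locale ring_filtration =
  fixes G :: "int \<Rightarrow> 'a::comm_ring_1 set"
  assumes zero_mem [simp]: "0 \<in> G k"
    and one_mem: "1 \<in> G 0"
    and add_mem: "x \<in> G k \<Longrightarrow> y \<in> G k \<Longrightarrow> x + y \<in> G k"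
    and uminus_mem: "x \<in> G k \<Longrightarrow> - x \<in> G k"
    and mult_mem: "x \<in> G j \<Longrightarrow> y \<in> G k \<Longrightarrow> x * y \<in> G (j + k)"
begin

lemma diff_mem: "x \<in> G k \<Longrightarrow> y \<in> G k \<Longrightarrow> x - y \<in> G k"
  using add_mem[of x k "- y"] uminus_mem by simp

lemma sum_mem: "(\<And>i. i \<in> I \<Longrightarrow> f i \<in> G k) \<Longrightarrow> sum f I \<in> G k"
  by (induction I rule: infinite_finite_induct) (auto intro: add_mem)

lemma prod_mem:
  "finite I \<Longrightarrow> (\<And>i. i \<in> I \<Longrightarrow> f i \<in> G (r i)) \<Longrightarrow> prod f I \<in> G (sum r I)"
  by (induction I rule: finite_induct) (auto intro: mult_mem one_mem)

lemma of_nat_mem: "of_nat n \<in> G 0"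
  by (induction n) (auto intro: add_mem one_mem)

lemma power_mem: "x \<in> G k \<Longrightarrow> x ^ n \<in> G (int n * k)"
  by (induction n) (auto intro: one_mem mult_mem simp: algebra_simps)

lemma det_mem:
  assumes A: "A \<in> carrier_mat n n"
    and mem: "\<And>i j. i < n \<Longrightarrow> j < n \<Longrightarrow> A $$ (i, j) \<in> G (r i + w j)"
  shows "det A \<in> G ((\<Sum>i<n. r i) + (\<Sum>j<n. w j))"
  unfolding det_def'[OF A]
proof (rule sum_mem)
  fix p assume "p \<in> {p. p permutes {0..<n}}"
  then have p: "p permutes {0..<n}" by simp
  have "(\<Prod>i = 0..<n. A $$ (i, p i)) \<in> G (\<Sum>i = 0..<n. r i + w (p i))"
    using permutes_in_image[OF p] by (intro prod_mem mem) auto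
  also have "(\<Sum>i = 0..<n. r i + w (p i)) = (\<Sum>i<n. r i) + (\<Sum>j<n. w j)"
    using sum.permute[OF p, of w] by (simp add: sum.distrib o_def lessThan_atLeast0)
  finally show "signof p * (\<Prod>i = 0..<n. A $$ (i, p i)) \<in> G ((\<Sum>i<n. r i) + (\<Sum>j<n. w j))"
    by (cases "sign p = 1") (auto simp: sign_def intro: uminus_mem)
qed

end

subsection \<open>Wronskians\<close>

locale derivation =
  fixes D :: "'a::field \<Rightarrow> 'a"
  assumes add: "D (x + y) = D x + D y"
    and mult: "D (x * y) = D x * y + x * D y"
begin

lemma zero [simp]: "D 0 = 0"
  using add[of 0 0] by (metis add.right_neutral add_left_cancel)

lemma one [simp]: "D 1 = 0"
  using mult[of 1 1] by (metis add.right_neutral add_left_cancel mult_1 mult.right_neutral)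

lemma sum: "D (sum f I) = (\<Sum>i\<in>I. D (f i))"
  by (induction I rule: infinite_finite_induct) (auto simp: add)

text \<open>The kernel vector of the Wronskian matrix is normalised at one entry; differentiating
  the relations kills that entry and costs only the last row.\<close>

lemma wronskian_dependent:
  assumes "finite S" "\<exists>j\<in>S. a j \<noteq> 0"
    and "\<And>i. i < card S \<Longrightarrow> (\<Sum>j\<in>S. a j * (D ^^ i) (f j)) = 0"
  shows "\<exists>b. (\<forall>j. D (b j) = 0) \<and> (\<exists>j\<in>S. b j \<noteq> 0) \<and> (\<Sum>j\<in>S. b j * f j) = 0"
  using assms
proof (induction "card S" arbitrary: S a)
  case 0
  then show ?case by auto
next
  case (Suc n)
  obtain s where s: "s \<in> S" "a s \<noteq> 0" using Suc.prems by blast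
  define a' where "a' = (\<lambda>j. a j / a s)"
  have rel: "(\<Sum>j\<in>S. a' j * (D ^^ i) (f j)) = 0" if "i < card S" for i
    using Suc.prems(3)[OF that] by (simp add: a'_def divide_simps flip: sum_divide_distrib)
  show ?case
  proof (cases "\<forall>j\<in>S. D (a' j) = 0")
    case True
    have "(\<Sum>j\<in>S. (if j \<in> S then a' j else 0) * f j) = 0"
      using rel[of 0] Suc.hyps(2) by (simp cong: sum.cong)
    moreover have "a' s \<noteq> 0" using s by (simp add: a'_def)
    ultimately show ?thesis using True s
      by (intro exI[of _ "\<lambda>j. if j \<in> S then a' j else 0"]) auto
  next
    case False
    have Ds: "D (a' s) = 0" using s by (simp add: a'_def)
    let ?S = "S - {s}"
    have card: "n = card ?S" using Suc.hyps(2) s Suc.prems(1) by simp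
    have "(\<Sum>j\<in>?S. D (a' j) * (D ^^ i) (f j)) = 0" if "i < card ?S" for i
    proof -
      have "0 = D (\<Sum>j\<in>S. a' j * (D ^^ i) (f j))" using rel[of i] that card Suc.hyps(2) by simp
      also have "\<dots> = (\<Sum>j\<in>S. D (a' j) * (D ^^ i) (f j)) + (\<Sum>j\<in>S. a' j * (D ^^ Suc i) (f j))"
        by (simp add: sum mult sum.distrib)
      also have "(\<Sum>j\<in>S. a' j * (D ^^ Suc i) (f j)) = 0"
        using rel[of "Suc i"] that card Suc.hyps(2) by simp
      finally show ?thesis using Ds s Suc.prems(1) by (simp add: sum.remove)
    qed
    moreover have "\<exists>j\<in>?S. D (a' j) \<noteq> 0" using False Ds by auto
    ultimately obtain b where b: "\<forall>j. D (b j) = 0" "\<exists>j\<in>?S. b j \<noteq> 0" "(\<Sum>j\<in>?S. b j * f j) = 0"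
      using Suc.hyps(1)[OF card, of "\<lambda>j. D (a' j)"] Suc.prems(1) by blast
    have "(\<Sum>j\<in>S. (b(s := 0)) j * f j) = (\<Sum>j\<in>?S. b j * f j)"
      using s Suc.prems(1) by (simp add: sum.remove)
    then show ?thesis using b by (intro exI[of _ "b(s := 0)"]) auto
  qed
qed

end

subsection \<open>Minimality of irreducible polynomials\<close>

lemma nonconst_poly_has_irreducible_factor:
  fixes c :: "'a::field poly"
  assumes "degree c > 0"
  shows "\<exists>p. irreducible p \<and> p dvd c"
  using assms
proof (induction "degree c" arbitrary: c rule: less_induct)
  case less
  show ?case
  proof (cases "irreducible c")
    case False
    then obtain a b where ab: "c = a * b" "\<not> is_unit a" "\<not> is_unit b"
      using less.prems by (auto simp: irreducible_def is_unit_poly_iff)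
    then have nz: "a \<noteq> 0" "b \<noteq> 0" using less.prems by auto
    then have "degree a > 0" "degree b > 0" using ab by (auto simp: is_unit_iff_degree)
    then have "degree a < degree c" using ab nz by (simp add: degree_mult_eq)
    then obtain p where "irreducible p" "p dvd a" using less.hyps \<open>degree a > 0\<close> by blast
    then show ?thesis using ab by auto
  qed auto
qed

text \<open>Gauss's lemma: a constant factor is cancelled one prime at a time.\<close>

lemma smult_eq_mult_imp_factor:
  fixes g m q :: "'a::field poly poly"
  assumes "c \<noteq> 0" "smult c g = m * q"
  shows "\<exists>m' q'. g = m' * q' \<and> degree m' = degree m"
  using assms
proof (induction "degree c" arbitrary: c m q rule: less_induct)
  case less
  show ?case
  proof (cases "degree c = 0")
    case True
    then obtain k where k: "c = [:k:]" "k \<noteq> 0" using less.prems(1) by (auto elim: degree_eq_zeroE)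
    have "smult [:inverse k:] (smult c g) = smult [:inverse k:] m * q"
      using less.prems(2) by simp
    then have "g = smult [:inverse k:] m * q" using k by (simp add: one_pCons[symmetric])
    then show ?thesis using k by (intro exI[of _ "smult [:inverse k:] m"] exI[of _ q]) auto
  next
    case False
    then obtain p where p: "irreducible p" "p dvd c"
      using nonconst_poly_has_irreducible_factor by blast
    then obtain c' where c': "c = p * c'" by (elim dvdE)
    have prime: "prime_elem [:p:]"
      using p by (intro lift_prime_elem_poly field_poly_irreducible_imp_prime)
    have p0: "p \<noteq> 0" "c' \<noteq> 0" using c' less.prems(1) by auto
    have "degree p > 0"
      using p p0 by (metis gr0I irreducible_not_unit is_unit_iff_degree)
    then have lt: "degree c' < degree c" using p0 c' by (simp add: degree_mult_eq)
    have eq: "[:p:] * smult c' g = m * q" using less.prems(2) c' by (simp add: mult.commute)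
    then have "[:p:] dvd m * q" by (metis dvd_triv_left)
    then consider m' where "m = [:p:] * m'" | q' where "q = [:p:] * q'"
      using prime by (auto simp: prime_elem_dvd_mult_iff elim!: dvdE)
    then show ?thesis
    proof cases
      case 1
      have "[:p:] * smult c' g = [:p:] * (m' * q)"
        unfolding eq unfolding 1 by (simp only: mult.assoc)
      then have "smult c' g = m' * q" using p0 by (subst (asm) mult_left_cancel) auto
      moreover have "degree m' = degree m" using 1 p0 by simp
      ultimately show ?thesis using less.hyps[OF lt p0(2)] by metis
    next
      case 2
      have "[:p:] * smult c' g = [:p:] * (m * q')"
        unfolding eq unfolding 2 by (simp only: ac_simps)
      then have "smult c' g = m * q'" using p0 by (subst (asm) mult_left_cancel) auto
      then show ?thesis using less.hyps[OF lt p0(2)] by metis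
    qed
  qed
qed

lemma irreducible_degree_minimal:
  fixes g B :: "'a::field poly poly" and ev :: "'a poly poly \<Rightarrow> 'b::idom"
  assumes hom: "comm_ring_hom ev" and inj: "\<And>p. ev [:p:] = 0 \<Longrightarrow> p = 0"
    and g: "irreducible g" "ev g = 0" and B: "B \<noteq> 0" "ev B = 0"
  shows "degree g \<le> degree B"
proof -
  interpret comm_ring_hom ev by (rule hom)
  define m where "m = arg_min degree (\<lambda>m. m \<noteq> 0 \<and> ev m = 0)"
  have m: "m \<noteq> 0" "ev m = 0" and min: "\<And>r. r \<noteq> 0 \<Longrightarrow> ev r = 0 \<Longrightarrow> degree m \<le> degree r"
    using arg_min_natI[of "\<lambda>m. m \<noteq> 0 \<and> ev m = 0" B degree]
      arg_min_nat_le[of "\<lambda>m. m \<noteq> 0 \<and> ev m = 0" _ degree] B unfolding m_def by auto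
  have "degree m > 0"
    using m inj by (metis degree_eq_zeroE gr0I pCons_0_0)
  obtain a q where a: "a \<noteq> 0" "smult a g = m * q + pseudo_mod g m"
    using pseudo_mod(1)[OF m(1)] by blast
  have "ev (smult a g) = ev ([:a:] * g)" by simp
  also have "\<dots> = 0" using g(2) by (simp only: hom_mult mult_zero_right)
  finally have "ev (pseudo_mod g m) = 0" using a(2) m(2) by (simp add: hom_distribs)
  then have "pseudo_mod g m = 0"
    using pseudo_mod(2)[OF m(1), of g] min[of "pseudo_mod g m"] by fastforce
  then obtain m' q' where f: "g = m' * q'" "degree m' = degree m"
    using smult_eq_mult_imp_factor[OF a(1), of g m q] a(2) by auto
  have "\<not> is_unit m'" using f \<open>degree m > 0\<close> by (auto simp: is_unit_poly_iff)
  then have "is_unit q'" using g(1) f irreducibleD by blast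
  then have "degree q' = 0" by (auto simp: is_unit_poly_iff)
  moreover have "g \<noteq> 0" using g(1) by auto
  ultimately have "degree g = degree m" using f by (auto simp: degree_mult_eq)
  then show ?thesis using min B by simp
qed

subsection \<open>Elimination\<close>

lemma sum_lessThan_add: "(\<Sum>j<m + n. f j) = (\<Sum>j<m. f j) + (\<Sum>j<n. f (m + j))"
  for f :: "nat \<Rightarrow> 'a::comm_monoid_add"
  by (induction n) (auto simp: add.assoc)

lemma elimination:
  fixes g Q :: "'a::idom poly"
  assumes G: "ring_filtration G"
    and deg: "degree g \<le> n" "degree Q \<le> m" "n > 0"
    and mem: "\<And>i. coeff g i \<in> G a" "\<And>i. coeff Q i \<in> G b"
    and nondeg: "\<And>A B. A * g + B * Q = 0 \<Longrightarrow> degree B < n \<Longrightarrow> A = 0 \<and> B = 0"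
  shows "\<exists>A B R. A * g + B * Q = [:R:] \<and> R \<noteq> 0 \<and> degree B < n \<and> R \<in> G (int m * a + int n * b)"
proof -
  interpret ring_filtration G by (rule G)
  define P where "P = (\<lambda>j. if j < m then monom 1 j * g else monom 1 (j - m) * Q)"
  define S where "S = mat (m + n) (m + n) (\<lambda>(i, j). coeff (P j) i)"
  have S: "S \<in> carrier_mat (m + n) (m + n)" by (simp add: S_def)
  define PA where "PA = (\<lambda>x :: nat \<Rightarrow> 'a. \<Sum>j<m. monom (x j) j)"
  define PB where "PB = (\<lambda>x :: nat \<Rightarrow> 'a. \<Sum>j<n. monom (x (m + j)) j)"
  have degB: "degree (PB x) < n" for x
    unfolding PB_def
  proof (rule degree_sum_less)
    show "degree (monom (x (m + i)) i) < n" if "i \<in> {..<n}" for i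
      using that degree_monom_le[of "x (m + i)" i] by simp
  qed (use deg in auto)
  have comb: "(\<Sum>j<m + n. smult (x j) (P j)) = PA x * g + PB x * Q" for x
  proof -
    have "(\<Sum>j<m. smult (x j) (P j)) = PA x * g"
      unfolding PA_def sum_distrib_right
      by (rule sum.cong) (auto simp: P_def smult_monom simp flip: mult_smult_left)
    moreover have "(\<Sum>j<n. smult (x (m + j)) (P (m + j))) = PB x * Q"
      unfolding PB_def sum_distrib_right
      by (rule sum.cong) (auto simp: P_def smult_monom simp flip: mult_smult_left)
    ultimately show ?thesis by (simp add: sum_lessThan_add)
  qed
  have high: "coeff (P j) i = 0" if "j < m + n" "i \<ge> m + n" for i j
    using that deg by (auto simp: P_def coeff_monom_mult intro!: coeff_eq_0)
  have row: "coeff (PA x * g + PB x * Q) i = (\<Sum>j<m + n. S $$ (i, j) * x j)" if "i < m + n" for x i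
    unfolding comb[symmetric] coeff_sum using that by (intro sum.cong) (auto simp: S_def)
  have row0: "coeff (PA x * g + PB x * Q) i = 0" if "i \<ge> m + n" for x i
    unfolding comb[symmetric] coeff_sum using that high by (intro sum.neutral) auto
  have det0: "det S \<noteq> 0"
  proof
    assume "det S = 0"
    then obtain x where x: "x \<in> carrier_vec (m + n)" "x \<noteq> 0\<^sub>v (m + n)" "S *\<^sub>v x = 0\<^sub>v (m + n)"
      using det_0_iff_vec_prod_zero[OF S] by auto
    let ?x = "\<lambda>j. x $ j"
    have "PA ?x * g + PB ?x * Q = 0"
    proof (rule poly_eqI)
      fix i
      show "coeff (PA ?x * g + PB ?x * Q) i = coeff 0 i"
      proof (cases "i < m + n")
        case True
        have "(\<Sum>j<m + n. S $$ (i, j) * ?x j) = (S *\<^sub>v x) $ i"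
          using True x(1) S by (simp add: scalar_prod_def lessThan_atLeast0)
        then show ?thesis using row[OF True, of ?x] x(3) True by simp
      qed (use row0 in simp)
    qed
    then have z: "PA ?x = 0" "PB ?x = 0" using nondeg degB by blast+
    have "x $ j = 0" if "j < m + n" for j
    proof (cases "j < m")
      case True
      have "coeff (PA ?x) j = x $ j"
        using True unfolding PA_def coeff_sum by simp
      then show ?thesis using z by simp
    next
      case False
      have "coeff (PB ?x) (j - m) = x $ j"
        using False that unfolding PB_def coeff_sum by (simp add: less_diff_conv2)
      then show ?thesis using z by simp
    qed
    then have "x = 0\<^sub>v (m + n)" using x(1) by (intro eq_vecI) auto
    then show False using x(2) by simp
  qed
  have "det S \<in> G ((\<Sum>i<m + n. 0) + (\<Sum>j<m + n. if j < m then a else b))"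
  proof (rule det_mem[OF S])
    fix i j assume "i < m + n" "j < m + n"
    then show "S $$ (i, j) \<in> G (0 + (if j < m then a else b))"
      using mem by (auto simp: S_def P_def coeff_monom_mult)
  qed
  also have "(\<Sum>i<m + n. 0) + (\<Sum>j<m + n. if j < m then a else b) = int m * a + int n * b"
    by (simp add: sum_lessThan_add)
  finally have detG: "det S \<in> G (int m * a + int n * b)" .
  let ?x = "\<lambda>j. adj_mat S $$ (j, 0)"
  have "PA ?x * g + PB ?x * Q = [:det S:]"
  proof (rule poly_eqI)
    fix i
    show "coeff (PA ?x * g + PB ?x * Q) i = coeff [:det S:] i"
    proof (cases "i < m + n")
      case True
      have "(\<Sum>j<m + n. S $$ (i, j) * ?x j) = (S * adj_mat S) $$ (i, 0)"
        using True S adj_mat(1)[OF S] deg(3) by (simp add: scalar_prod_def lessThan_atLeast0)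
      also have "\<dots> = coeff [:det S:] i"
        using True deg(3) by (auto simp: adj_mat(2)[OF S] coeff_pCons split: nat.splits)
      finally show ?thesis using row[OF True] by simp
    next
      case False
      then show ?thesis using row0 deg(3) by (auto simp: coeff_pCons split: nat.splits)
    qed
  qed
  then show ?thesis using det0 detG degB by blast
qed

subsection \<open>Degree filtrations\<close>

definition deg_le :: "int \<Rightarrow> 'a::zero poly set" where
  "deg_le k = {p. p \<noteq> 0 \<longrightarrow> int (degree p) \<le> k}"

lemma deg_leI: "(\<And>i. coeff p i \<noteq> 0 \<Longrightarrow> int i \<le> k) \<Longrightarrow> p \<in> deg_le k"
  by (auto simp: deg_le_def)

lemma deg_leD: "p \<in> deg_le k \<Longrightarrow> coeff p i \<noteq> 0 \<Longrightarrow> int i \<le> k"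
  using le_degree[of p i] by (cases "p = 0") (auto simp: deg_le_def)

lemma ring_filtration_deg_le: "ring_filtration (deg_le :: int \<Rightarrow> 'a::comm_ring_1 poly set)"
proof
  fix x y :: "'a poly" and j k :: int
  show "x \<in> deg_le k \<Longrightarrow> y \<in> deg_le k \<Longrightarrow> x + y \<in> deg_le k"
    by (rule deg_leI) (metis add_0 coeff_add deg_leD)
  show "x \<in> deg_le j \<Longrightarrow> y \<in> deg_le k \<Longrightarrow> x * y \<in> deg_le (j + k)"
    using degree_mult_le[of x y] by (cases "x = 0"; cases "y = 0") (auto simp: deg_le_def)
qed (auto simp: deg_le_def)

definition bideg_le :: "int \<Rightarrow> 'a::comm_ring_1 poly poly set" where
  "bideg_le k = {P. P \<in> deg_le k \<and> (\<forall>i. coeff P i \<in> deg_le k)}"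

lemma ring_filtration_bideg_le: "ring_filtration (bideg_le :: int \<Rightarrow> 'a::comm_ring_1 poly poly set)"
proof -
  interpret ring_filtration "deg_le :: int \<Rightarrow> 'a poly set" by (rule ring_filtration_deg_le)
  interpret Y: ring_filtration "deg_le :: int \<Rightarrow> 'a poly poly set" by (rule ring_filtration_deg_le)
  show ?thesis
    by standard (auto simp: bideg_le_def coeff_mult
      intro: add_mem Y.add_mem uminus_mem Y.uminus_mem Y.mult_mem sum_mem mult_mem one_mem Y.one_mem)
qed

definition euler :: "'a::idom poly \<Rightarrow> 'a poly" where
  "euler p = pCons 0 (pderiv p)"

lemma coeff_euler: "coeff (euler p) i = of_nat i * coeff p i"
  by (cases i) (auto simp: euler_def coeff_pderiv)

lemma euler_0 [simp]: "euler 0 = 0"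
  by (simp add: euler_def)

lemma euler_pCons: "euler (pCons a p) = pCons 0 (p + euler p)"
  by (simp add: euler_def pderiv_pCons)

lemma euler_deg_le: "p \<in> deg_le k \<Longrightarrow> euler p \<in> deg_le k"
  by (rule deg_leI) (metis coeff_euler deg_leD mult_zero_right)

lemma euler_bideg_le: "(P :: 'a::idom poly poly) \<in> bideg_le k \<Longrightarrow> euler P \<in> bideg_le k"
  and map_euler_bideg_le: "P \<in> bideg_le k \<Longrightarrow> map_poly euler P \<in> bideg_le k"
proof -
  interpret F: ring_filtration "deg_le :: int \<Rightarrow> 'a poly set" by (rule ring_filtration_deg_le)
  assume P: "P \<in> bideg_le k"
  then show "euler P \<in> bideg_le k"
    unfolding bideg_le_def
    using F.mult_mem[OF F.of_nat_mem, of _ k] by (auto simp: coeff_euler intro: euler_deg_le)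
  have "coeff (map_poly euler P) i = euler (coeff P i)" for i
    by (simp add: coeff_map_poly)
  then show "map_poly euler P \<in> bideg_le k"
    using P unfolding bideg_le_def
    by (auto intro!: euler_deg_le) (metis coeff_0 deg_leD deg_leI euler_0)
qed

lemma total_degree_bideg_le: "g \<in> bideg_le (int (total_degree g))"
proof -
  have "finite {i. coeff g i \<noteq> 0}" using MOST_coeff_eq_0[of g] by (simp add: MOST_iff_cofinite)
  then have "finite {i + degree (coeff g i) | i. coeff g i \<noteq> 0}" by simp
  then have *: "i + degree (coeff g i) \<le> total_degree g" if "coeff g i \<noteq> 0" for i
    unfolding total_degree_def using that by (intro Max_ge) auto
  show ?thesis
    unfolding bideg_le_def using *
    by (auto intro!: deg_leI) (metis add_leD1, metis add_leD2 coeff_0 le_degree order_trans)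
qed

subsection \<open>Laurent series\<close>

definition val_ge :: "int \<Rightarrow> 'b::field fls set" where
  "val_ge k = {x. x \<noteq> 0 \<longrightarrow> k \<le> fls_subdegree x}"

lemma val_geI: "(\<And>n. n < k \<Longrightarrow> fls_nth x n = 0) \<Longrightarrow> x \<in> val_ge k"
  by (auto simp: val_ge_def intro: fls_subdegree_geI)

lemma val_geD: "x \<in> val_ge k \<Longrightarrow> n < k \<Longrightarrow> fls_nth x n = 0"
  by (cases "x = 0") (auto simp: val_ge_def)

lemma val_ge_mono: "x \<in> val_ge j \<Longrightarrow> k \<le> j \<Longrightarrow> x \<in> val_ge k"
  by (auto simp: val_ge_def)

interpretation val_ge: ring_filtration "val_ge :: int \<Rightarrow> 'b::field fls set"
proof
  fix x y :: "'b fls" and j k :: int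
  show "x \<in> val_ge k \<Longrightarrow> y \<in> val_ge k \<Longrightarrow> x + y \<in> val_ge k"
    by (rule val_geI) (simp add: val_geD)
  show "x \<in> val_ge j \<Longrightarrow> y \<in> val_ge k \<Longrightarrow> x * y \<in> val_ge (j + k)"
    by (auto simp: val_ge_def)
qed (auto simp: val_ge_def)

definition fls_euler :: "'b::field fls \<Rightarrow> 'b fls" where
  "fls_euler x = fls_X * fls_deriv x"

lemma fls_euler_nth: "fls_nth (fls_euler x) n = of_int n * fls_nth x n"
  by (simp add: fls_euler_def fls_X_times_conv_shift)

interpretation fls_euler: derivation "fls_euler :: 'b::field fls \<Rightarrow> 'b fls"
  by standard (simp_all add: fls_euler_def algebra_simps)

lemma fls_euler_const [simp]: "fls_euler (fls_const c) = 0"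
  by (simp add: fls_euler_def)

lemma fls_euler_eq_0D: "fls_euler x = 0 \<Longrightarrow> x = fls_const (fls_nth x 0)"
  for x :: "'b::field_char_0 fls"
  by (simp add: fls_euler_def fls_deriv_eq_0_iff)

lemma fls_euler_val_ge: "x \<in> val_ge k \<Longrightarrow> fls_euler x \<in> val_ge k"
  by (rule val_geI) (simp add: fls_euler_nth val_geD)

lemma fls_euler_power: "x * fls_euler (x ^ n) = of_nat n * x ^ n * fls_euler x"
  by (induction n) (auto simp: fls_euler.mult algebra_simps)

lemma fls_euler_X_power: "fls_euler (fls_X ^ n) = of_nat n * fls_X ^ n"
  by (rule fls_eqI) (auto simp: fls_euler_nth fls_of_nat)

subsection \<open>Evaluation of bivariate polynomials at Laurent series\<close>

lemma comm_ring_hom_eval: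
  assumes "comm_ring_hom h"
  shows "comm_ring_hom (\<lambda>p. poly (map_poly h p) x)"
proof -
  interpret comm_ring_hom h by fact
  interpret m: map_poly_comm_ring_hom h ..
  show ?thesis by standard (simp_all add: m.hom_add m.hom_mult)
qed

lemma comm_ring_hom_const_to_ac: "comm_ring_hom (\<lambda>c. fls_const (to_ac c))"
  by standard (simp_all flip: fls_plus_const)

definition fls_of_poly :: "nat \<Rightarrow> 'a::field poly \<Rightarrow> 'a alg_closure fls" where
  "fls_of_poly e p = poly (map_poly (\<lambda>c. fls_const (to_ac c)) p) (fls_X ^ e)"

lemma comm_ring_hom_fls_of_poly: "comm_ring_hom (fls_of_poly e)"
  unfolding fls_of_poly_def[abs_def] by (rule comm_ring_hom_eval[OF comm_ring_hom_const_to_ac])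

interpretation fls_of_poly: comm_ring_hom "fls_of_poly e"
  by (rule comm_ring_hom_fls_of_poly)

lemma fls_of_poly_pCons:
  "fls_of_poly e (pCons a p) = fls_const (to_ac a) + fls_X ^ e * fls_of_poly e p"
  by (simp add: fls_of_poly_def Polynomial.map_poly_pCons)

lemma fls_of_poly_nth:
  assumes "e > 0"
  shows "fls_nth (fls_of_poly e p) k
    = (if k \<ge> 0 \<and> int e dvd k then to_ac (coeff p (nat (k div int e))) else 0)"
proof (induction p arbitrary: k)
  case 0
  then show ?case by simp
next
  case (pCons a p)
  have nth: "fls_nth (fls_X ^ e * fls_of_poly e p) k = fls_nth (fls_of_poly e p) (k - int e)"
    by (simp add: fls_X_power_times_conv_shift)
  show ?case
  proof (cases "k \<ge> 0 \<and> int e dvd k")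
    case True
    then obtain i where k: "k = int e * int i"
      by (metis assms dvdE of_nat_0_less_iff zero_le_mult_iff nonneg_int_cases not_less)
    show ?thesis
    proof (cases i)
      case 0
      then show ?thesis
        using k nth pCons.IH[of "- int e"] assms by (simp add: fls_of_poly_pCons)
    next
      case (Suc i')
      then have "k - int e = int e * int i'" using k by (simp add: algebra_simps)
      then show ?thesis
        using pCons.IH[of "k - int e"] assms k Suc nth by (simp add: fls_of_poly_pCons nat_add_distrib)
    qed
  next
    case False
    then have "\<not> (k - int e \<ge> 0 \<and> int e dvd k - int e)"
      using dvd_add[of "int e" "k - int e" "int e"] by auto
    then show ?thesis
      using pCons.IH[of "k - int e"] False by (auto simp: fls_of_poly_pCons nth)
  qed
qed

lemma fls_of_poly_val_ge: "e > 0 \<Longrightarrow> fls_of_poly e p \<in> val_ge 0"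
  by (rule val_geI) (simp add: fls_of_poly_nth)

lemma fls_of_poly_nonzero:
  assumes "e > 0" "p \<noteq> 0"
  shows "fls_of_poly e p \<noteq> 0" "fls_subdegree (fls_of_poly e p) \<le> int e * int (degree p)"
proof -
  have "fls_nth (fls_of_poly e p) (int e * int (degree p)) \<noteq> 0"
    using assms by (simp add: fls_of_poly_nth)
  then show "fls_of_poly e p \<noteq> 0" "fls_subdegree (fls_of_poly e p) \<le> int e * int (degree p)"
    by (auto intro: fls_subdegree_leI)
qed

lemma fls_euler_of_poly: "fls_euler (fls_of_poly e p) = of_nat e * fls_of_poly e (euler p)"
  by (induction p)
    (simp_all add: fls_of_poly_pCons euler_pCons fls_euler.add fls_euler.mult fls_euler_X_power
      fls_of_poly.hom_add algebra_simps)

definition eval_at :: "nat \<Rightarrow> 'a alg_closure fls \<Rightarrow> 'a::field poly poly \<Rightarrow> 'a alg_closure fls" where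
  "eval_at e \<Phi> P = poly (map_poly (fls_of_poly e) P) \<Phi>"

lemma comm_ring_hom_eval_at: "comm_ring_hom (eval_at e \<Phi>)"
  unfolding eval_at_def[abs_def] by (rule comm_ring_hom_eval[OF comm_ring_hom_fls_of_poly])

interpretation eval_at: comm_ring_hom "eval_at e \<Phi>"
  by (rule comm_ring_hom_eval_at)

lemma eval_at_pCons: "eval_at e \<Phi> (pCons a P) = fls_of_poly e a + \<Phi> * eval_at e \<Phi> P"
  by (simp add: eval_at_def Polynomial.map_poly_pCons)

lemma eval_at_altdef: "eval_at e \<Phi> P = (\<Sum>i\<le>degree P. fls_of_poly e (coeff P i) * \<Phi> ^ i)"
proof -
  have "degree (map_poly (fls_of_poly e) P) \<le> degree P" by (rule map_poly_degree_leq)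
  then show ?thesis
    unfolding eval_at_def by (subst poly_as_sum_of_monoms'[symmetric, of "map_poly (fls_of_poly e) P" "degree P"])
      (simp_all add: poly_sum poly_monom coeff_map_poly)
qed

lemma euler_eval_at:
  assumes "\<Phi> \<noteq> 0"
  shows "fls_euler (eval_at e \<Phi> P) = of_nat e * eval_at e \<Phi> (map_poly euler P)
    + fls_euler \<Phi> / \<Phi> * eval_at e \<Phi> (euler P)"
proof (induction P)
  case (pCons a P)
  have "fls_euler (eval_at e \<Phi> (pCons a P))
    = of_nat e * fls_of_poly e (euler a) + fls_euler \<Phi> * eval_at e \<Phi> P
      + \<Phi> * fls_euler (eval_at e \<Phi> P)"
    by (simp add: eval_at_pCons fls_euler.add fls_euler.mult fls_euler_of_poly)
  then show ?case
    using assms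
    by (simp add: pCons.IH eval_at_pCons Polynomial.map_poly_pCons euler_pCons eval_at.hom_add field_simps)
qed simp

subsection \<open>The tangential derivation of a plane curve at a Laurent series branch\<close>

lemma sum_lessThan_choose_2: "(\<Sum>i<l. int i) = int (l choose 2)"
  by (induction l) (simp_all add: numeral_2_eq_2)

locale laurent_root =
  fixes g :: "'a::field_char_0 poly poly" and e d :: nat and \<Phi> :: "'a alg_closure fls"
  assumes e_pos: "e > 0" and irred: "irreducible g" and deg_pos: "degree g > 0"
    and bideg: "g \<in> bideg_le (int d)" and \<Phi>_nz: "\<Phi> \<noteq> 0" and root: "eval_at e \<Phi> g = 0"
begin

abbreviation ev where "ev \<equiv> eval_at e \<Phi>"
abbreviation s where "s \<equiv> fls_subdegree \<Phi>"

lemma degree_g_le: "degree g \<le> d"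
  using bideg deg_pos by (auto simp: bideg_le_def deg_le_def)

lemma ev_eq_0_imp_degree_ge: "B \<noteq> 0 \<Longrightarrow> ev B = 0 \<Longrightarrow> degree g \<le> degree B"
  using irred root
  by (intro irreducible_degree_minimal[OF comm_ring_hom_eval_at[of e \<Phi>]])
    (auto simp: eval_at_pCons dest: fls_of_poly_nonzero(1)[OF e_pos])

lemma root_val_ge: "- (int e * int d) \<le> s"
proof (rule ccontr)
  assume "\<not> ?thesis"
  then have s: "s < - (int e * int d)" by simp
  define n where "n = degree g"
  let ?t = "\<lambda>i. fls_of_poly e (coeff g i) * \<Phi> ^ i"
  have lc: "coeff g n \<noteq> 0" using deg_pos by (auto simp: n_def)
  have "(\<Sum>i<n. ?t i) \<in> val_ge (int (n - 1) * s)"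
  proof (rule val_ge.sum_mem)
    fix i assume i: "i \<in> {..<n}"
    have "?t i \<in> val_ge (0 + int i * s)"
      by (intro val_ge.mult_mem fls_of_poly_val_ge e_pos val_ge.power_mem) (simp add: val_ge_def)
    moreover have "int (n - 1) * s \<le> 0 + int i * s"
    proof -
      have "s \<le> 0" using s by (smt (verit) mult_nonneg_nonneg of_nat_0_le_iff)
      then show ?thesis using i by (auto intro: mult_right_mono_neg)
    qed
    ultimately show "?t i \<in> val_ge (int (n - 1) * s)" by (rule val_ge_mono)
  qed
  moreover have "?t n = - (\<Sum>i<n. ?t i)"
    using root by (simp add: eval_at_altdef n_def flip: lessThan_Suc_atMost) (simp add: eq_neg_iff_add_eq_0 add.commute)
  ultimately have "?t n \<in> val_ge (int (n - 1) * s)" by (simp add: val_ge.uminus_mem)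
  moreover have "?t n \<noteq> 0" using \<Phi>_nz fls_of_poly_nonzero(1)[OF e_pos lc] by simp
  ultimately have "int (n - 1) * s \<le> fls_subdegree (fls_of_poly e (coeff g n)) + int n * s"
    using \<Phi>_nz fls_of_poly_nonzero(1)[OF e_pos lc] by (simp add: val_ge_def fls_subdegree_pow)
  also have "fls_subdegree (fls_of_poly e (coeff g n)) \<le> int e * int d"
  proof -
    have "coeff g n \<in> deg_le (int d)" using bideg by (simp add: bideg_le_def)
    then have "int (degree (coeff g n)) \<le> int d" using lc by (simp add: deg_le_def)
    then have "int e * int (degree (coeff g n)) \<le> int e * int d" by (intro mult_left_mono) auto
    then show ?thesis using fls_of_poly_nonzero(2)[OF e_pos lc] by linarith
  qed
  finally have "int (n - 1) * s \<le> int e * int d + int n * s" by simp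
  moreover have "int n * s = int (n - 1) * s + s"
    using deg_pos by (cases n) (simp_all add: n_def algebra_simps)
  ultimately have "0 \<le> int e * int d + s" by linarith
  then show False using s by simp
qed

lemma ev_val_ge:
  assumes "degree P \<le> d"
  shows "ev P \<in> val_ge (- (int e * (int d)\<^sup>2))"
  unfolding eval_at_altdef
proof (rule val_ge.sum_mem)
  fix i assume "i \<in> {..degree P}"
  then have i: "i \<le> d" using assms by simp
  have "fls_of_poly e (coeff P i) * \<Phi> ^ i \<in> val_ge (0 + int i * s)"
    by (intro val_ge.mult_mem fls_of_poly_val_ge e_pos val_ge.power_mem) (simp add: val_ge_def)
  moreover have "- (int e * (int d)\<^sup>2) \<le> 0 + int i * s"
  proof -
    have "int i * (int e * int d) \<le> int d * (int e * int d)"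
      using i by (intro mult_right_mono) auto
    moreover have "int i * - (int e * int d) \<le> int i * s"
      using root_val_ge by (intro mult_left_mono) auto
    ultimately show ?thesis by (simp add: power2_eq_square algebra_simps)
  qed
  ultimately show "fls_of_poly e (coeff P i) * \<Phi> ^ i \<in> val_ge (- (int e * (int d)\<^sup>2))"
    by (rule val_ge_mono)
qed

lemma ev_val_le:
  assumes Q: "Q \<in> bideg_le (int m)" and nz: "ev Q \<noteq> 0"
  shows "fls_subdegree (ev Q) \<le> 2 * int e * int d * int m + int e * (int d)\<^sup>2"
proof -
  have degQ: "degree Q \<le> m" using Q nz by (cases "Q = 0") (auto simp: bideg_le_def deg_le_def)
  have "\<exists>A B R. A * g + B * Q = [:R:] \<and> R \<noteq> 0 \<and> degree B < degree g
      \<and> R \<in> deg_le (int m * int d + int (degree g) * int m)"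
  proof (rule elimination[OF ring_filtration_deg_le order_refl degQ deg_pos])
    fix A B assume eq: "A * g + B * Q = 0" and deg: "degree B < degree g"
    then have "ev (A * g + B * Q) = 0" by simp
    then have "ev B = 0" using nz root by (simp add: eval_at.hom_add eval_at.hom_mult)
    then have "B = 0" using ev_eq_0_imp_degree_ge[of B] deg by fastforce
    then show "A = 0 \<and> B = 0" using eq deg_pos by auto
  qed (use Q bideg in \<open>auto simp: bideg_le_def\<close>)
  then obtain A B R where R: "A * g + B * Q = [:R:]" "R \<noteq> 0" "degree B < degree g"
    "R \<in> deg_le (int m * int d + int (degree g) * int m)" by blast
  have eq: "ev B * ev Q = fls_of_poly e R"
    using arg_cong[OF R(1), of ev] root by (simp add: eval_at.hom_add eval_at.hom_mult eval_at_pCons)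
  have R0: "fls_of_poly e R \<noteq> 0" using fls_of_poly_nonzero(1)[OF e_pos R(2)] .
  then have B0: "ev B \<noteq> 0" using eq by auto
  have "fls_subdegree (ev B) + fls_subdegree (ev Q) = fls_subdegree (fls_of_poly e R)"
    using eq nz B0 by (metis fls_subdegree_mult)
  also have "\<dots> \<le> int e * int (degree R)" by (rule fls_of_poly_nonzero(2)[OF e_pos R(2)])
  also have "\<dots> \<le> int e * (2 * int d * int m)"
  proof (rule mult_left_mono)
    have "int (degree R) \<le> int m * int d + int (degree g) * int m"
      using R(2,4) by (simp add: deg_le_def)
    also have "int (degree g) * int m \<le> int d * int m"
      using degree_g_le by (intro mult_right_mono) auto
    finally show "int (degree R) \<le> 2 * int d * int m" by (simp add: algebra_simps)
  qed simp
  finally have "fls_subdegree (ev B) + fls_subdegree (ev Q) \<le> int e * (2 * int d * int m)" .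
  moreover have "- (int e * (int d)\<^sup>2) \<le> fls_subdegree (ev B)"
    using ev_val_ge[of B] R(3) degree_g_le B0 by (simp add: val_ge_def)
  ultimately show ?thesis by (simp add: algebra_simps)
qed

lemma ev_val_le_const:
  assumes Q: "Q \<in> bideg_le 0" and nz: "ev Q \<noteq> 0"
  shows "fls_subdegree (ev Q) \<le> 0"
proof -
  have "degree Q = 0" using Q nz by (cases "Q = 0") (auto simp: bideg_le_def deg_le_def)
  then obtain p where p: "Q = [:p:]" by (auto elim: degree_eq_zeroE)
  have "p \<noteq> 0" using p nz by auto
  moreover have "coeff Q 0 \<in> deg_le 0" using Q by (simp add: bideg_le_def)
  ultimately have "degree p = 0" using p by (simp add: deg_le_def)
  then show ?thesis using fls_of_poly_nonzero(2)[OF e_pos \<open>p \<noteq> 0\<close>] p by (simp add: eval_at_pCons)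
qed

text \<open>Rescaling the Euler derivation by \<open>\<Phi> g\<^sub>Y(X, \<Phi>)\<close> clears the denominator of
  \<open>\<Phi>' = - g\<^sub>X / g\<^sub>Y\<close>, so that polynomials in \<open>X\<close> and \<open>\<Phi>\<close> are preserved.\<close>

definition D :: "'a alg_closure fls \<Rightarrow> 'a alg_closure fls" where
  "D x = ev (euler g) * fls_euler x"

definition delta :: "'a poly poly \<Rightarrow> 'a poly poly" where
  "delta P = of_nat e * (map_poly euler P * euler g - map_poly euler g * euler P)"

definition log_deriv :: "nat \<Rightarrow> nat \<Rightarrow> 'a poly poly" where
  "log_deriv a b = of_nat e * (of_nat a * euler g - of_nat b * map_poly euler g)"

definition branch_monom :: "nat \<Rightarrow> nat \<Rightarrow> 'a alg_closure fls" where
  "branch_monom a b = fls_X ^ (e * a) * \<Phi> ^ b"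

primrec cofac :: "nat \<Rightarrow> nat \<Rightarrow> nat \<Rightarrow> 'a poly poly" where
  "cofac a b 0 = 1"
| "cofac a b (Suc i) = delta (cofac a b i) + log_deriv a b * cofac a b i"

sublocale D: derivation D
  by standard (simp_all add: D_def fls_euler.add fls_euler.mult algebra_simps)

lemma ev_euler: "ev (euler g) = \<Phi> * ev (pderiv g)"
  by (simp add: euler_def eval_at_pCons)

lemma ev_pderiv_nz: "ev (pderiv g) \<noteq> 0"
proof
  assume "ev (pderiv g) = 0"
  moreover have "pderiv g \<noteq> 0" using deg_pos by (simp add: pderiv_eq_0_iff)
  ultimately have "degree g \<le> degree (pderiv g)" by (intro ev_eq_0_imp_degree_ge)
  then show False using deg_pos by (simp add: degree_pderiv)
qed

lemma ev_euler_nz: "ev (euler g) \<noteq> 0"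
  using ev_pderiv_nz \<Phi>_nz by (simp add: ev_euler)

lemma ev_euler_log: "fls_euler \<Phi> / \<Phi> * ev (euler g) = - (of_nat e * ev (map_poly euler g))"
  using euler_eval_at[OF \<Phi>_nz, of e g] root by (simp add: eq_neg_iff_add_eq_0 add.commute)

lemma D_ev: "D (ev P) = ev (delta P)"
proof -
  have "D (ev P) = of_nat e * ev (map_poly euler P) * ev (euler g)
      + fls_euler \<Phi> / \<Phi> * ev (euler g) * ev (euler P)"
    by (simp add: D_def euler_eval_at[OF \<Phi>_nz] algebra_simps)
  then show ?thesis
    unfolding ev_euler_log delta_def
    by (simp add: eval_at.hom_mult eval_at.hom_minus eval_at.hom_of_nat algebra_simps)
qed

lemma D_branch_monom: "D (branch_monom a b) = ev (log_deriv a b) * branch_monom a b"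
proof -
  have pow: "fls_euler (\<Phi> ^ b) = of_nat b * (fls_euler \<Phi> / \<Phi>) * \<Phi> ^ b"
    using fls_euler_power[of \<Phi> b] \<Phi>_nz by (simp add: field_simps)
  have "D (branch_monom a b) = (of_nat (e * a) * ev (euler g)
      + of_nat b * (fls_euler \<Phi> / \<Phi> * ev (euler g))) * branch_monom a b"
    by (simp add: D_def branch_monom_def fls_euler.mult fls_euler_X_power pow algebra_simps)
  then show ?thesis
    unfolding ev_euler_log log_deriv_def
    by (simp add: eval_at.hom_mult eval_at.hom_minus eval_at.hom_of_nat algebra_simps)
qed

lemma D_iter_branch_monom: "(D ^^ i) (branch_monom a b) = branch_monom a b * ev (cofac a b i)"
  by (induction i)
    (simp_all add: D.mult D_ev D_branch_monom eval_at.hom_add eval_at.hom_mult algebra_simps)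

lemma D_val_ge: "x \<in> val_ge k \<Longrightarrow> D x \<in> val_ge (fls_subdegree (ev (euler g)) + k)"
  unfolding D_def by (intro val_ge.mult_mem fls_euler_val_ge) (simp add: val_ge_def)

lemma D_iter_val_ge: "x \<in> val_ge k \<Longrightarrow> (D ^^ i) x \<in> val_ge (int i * fls_subdegree (ev (euler g)) + k)"
proof (induction i)
  case (Suc i)
  then show ?case using D_val_ge[OF Suc.IH[OF Suc.prems]] by (simp add: algebra_simps)
qed simp

lemma branch_monom_nz [simp]: "branch_monom a b \<noteq> 0"
  using \<Phi>_nz by (simp add: branch_monom_def)

lemma branch_monom_val: "fls_subdegree (branch_monom a b) = int (e * a) + int b * s"
  using \<Phi>_nz by (simp add: branch_monom_def fls_subdegree_pow)

lemma cofac_val_ge: "ev (cofac a b i) \<in> val_ge (int i * fls_subdegree (ev (euler g)))"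
proof -
  have "branch_monom a b * ev (cofac a b i)
      \<in> val_ge (int i * fls_subdegree (ev (euler g)) + fls_subdegree (branch_monom a b))"
    unfolding D_iter_branch_monom[symmetric] by (rule D_iter_val_ge) (simp add: val_ge_def)
  then show ?thesis by (auto simp: val_ge_def)
qed

lemma cofac_bideg_le: "cofac a b i \<in> bideg_le (int i * int d)"
proof -
  interpret ring_filtration "bideg_le :: int \<Rightarrow> 'a poly poly set" by (rule ring_filtration_bideg_le)
  have E: "euler g \<in> bideg_le (int d)" "map_poly euler g \<in> bideg_le (int d)"
    using bideg by (auto intro: euler_bideg_le map_euler_bideg_le)
  have nat: "of_nat n * x \<in> bideg_le k" if "x \<in> bideg_le k" for n k and x :: "'a poly poly"
    using mult_mem[OF of_nat_mem that] by simp
  show ?thesis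
  proof (induction i)
    case 0
    then show ?case using one_mem by simp
  next
    case (Suc i)
    have "delta (cofac a b i) \<in> bideg_le (int d + int i * int d)"
      unfolding delta_def
      using mult_mem[OF E(1) map_euler_bideg_le[OF Suc]] mult_mem[OF E(2) euler_bideg_le[OF Suc]]
      by (intro nat diff_mem) (simp_all add: mult.commute)
    moreover have "log_deriv a b \<in> bideg_le (int d)"
      unfolding log_deriv_def by (intro nat diff_mem E)
    ultimately show ?case
      using Suc by (auto simp: algebra_simps intro!: add_mem dest: mult_mem)
  qed
qed

lemma D_const_mult: "D (fls_const c * x) = fls_const c * D x"
  by (simp add: D_def fls_euler.mult)

lemma D_eq_0D: "D x = 0 \<Longrightarrow> x = fls_const (fls_nth x 0)"
  using ev_euler_nz fls_euler_eq_0D by (auto simp: D_def)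

lemma D_iter_lincomb:
  "(D ^^ i) (\<Sum>j\<in>J. fls_const (c j) * f j) = (\<Sum>j\<in>J. fls_const (c j) * (D ^^ i) (f j))"
  by (induction i) (simp_all add: D.sum D_const_mult)

definition wronskian :: "nat \<Rightarrow> (nat \<Rightarrow> nat) \<Rightarrow> (nat \<Rightarrow> nat) \<Rightarrow> 'a poly poly mat" where
  "wronskian l \<alpha> \<beta> = mat l l (\<lambda>(i, j). cofac (\<alpha> j) (\<beta> j) i)"

lemma wronskian_bideg_le: "det (wronskian l \<alpha> \<beta>) \<in> bideg_le (int (d * (l choose 2)))"
proof -
  interpret ring_filtration "bideg_le :: int \<Rightarrow> 'a poly poly set" by (rule ring_filtration_bideg_le)
  have "det (wronskian l \<alpha> \<beta>) \<in> bideg_le ((\<Sum>i<l. int i * int d) + (\<Sum>j<l. 0))"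
    by (rule det_mem) (simp_all add: wronskian_def cofac_bideg_le)
  then show ?thesis by (simp add: sum_lessThan_choose_2 mult.commute flip: sum_distrib_right)
qed

lemma wronskian_nz:
  assumes indep: "\<And>a. (\<Sum>j<l. fls_const (a j) * branch_monom (\<alpha> j) (\<beta> j)) = 0 \<Longrightarrow> \<forall>j<l. a j = 0"
  shows "ev (det (wronskian l \<alpha> \<beta>)) \<noteq> 0"
proof
  let ?A = "map_mat ev (wronskian l \<alpha> \<beta>)"
  let ?f = "\<lambda>j. branch_monom (\<alpha> j) (\<beta> j)"
  assume "ev (det (wronskian l \<alpha> \<beta>)) = 0"
  then have "det ?A = 0" by (simp add: eval_at.hom_det)
  moreover have A: "?A \<in> carrier_mat l l" by (simp add: wronskian_def)
  ultimately obtain x where x: "x \<in> carrier_vec l" "x \<noteq> 0\<^sub>v l" "?A *\<^sub>v x = 0\<^sub>v l"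
    using det_0_iff_vec_prod_zero_field by blast
  have ex: "\<exists>j<l. x $ j \<noteq> 0"
  proof (rule ccontr)
    assume "\<not> ?thesis"
    then have "x = 0\<^sub>v l" using x(1) by (intro eq_vecI) auto
    then show False using x(2) by simp
  qed
  have "(\<Sum>j<l. x $ j / ?f j * (D ^^ i) (?f j)) = 0" if "i < l" for i
  proof -
    have "(\<Sum>j<l. x $ j / ?f j * (D ^^ i) (?f j)) = (?A *\<^sub>v x) $ i"
      using that x(1) A
      by (auto simp: wronskian_def scalar_prod_def D_iter_branch_monom lessThan_atLeast0 intro!: sum.cong)
    then show ?thesis using x(3) that by simp
  qed
  then obtain b where b: "\<forall>j. D (b j) = 0" "\<exists>j\<in>{..<l}. b j \<noteq> 0" "(\<Sum>j<l. b j * ?f j) = 0"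
    using D.wronskian_dependent[of "{..<l}" "\<lambda>j. x $ j / ?f j" ?f] ex by auto
  have bc: "b j = fls_const (fls_nth (b j) 0)" for j using b(1) D_eq_0D by blast
  then have "(\<Sum>j<l. fls_const (fls_nth (b j) 0) * ?f j) = 0" using b(3) by simp
  then have "\<forall>j<l. fls_nth (b j) 0 = 0" by (rule indep)
  then show False using b(2) bc by (metis fls_const_0 lessThan_iff)
qed

lemma lincomb_val_le:
  assumes indep: "\<And>a. (\<Sum>j<l. fls_const (a j) * branch_monom (\<alpha> j) (\<beta> j)) = 0 \<Longrightarrow> \<forall>j<l. a j = 0"
    and k: "k < l" "c k \<noteq> 0"
  defines "F \<equiv> \<Sum>j<l. fls_const (c j) * branch_monom (\<alpha> j) (\<beta> j)"
  shows "fls_subdegree F \<le> int e * int (\<alpha> k) + s * int (\<beta> k)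
    + (int e * (2 * int d * (4 * int d + 1)) - s) * int (l choose 2)"
proof -
  define A where "A = map_mat ev (wronskian l \<alpha> \<beta>)"
  let ?f = "\<lambda>j. branch_monom (\<alpha> j) (\<beta> j)"
  define x where "x = vec l (\<lambda>j. fls_const (c j) * ?f j)"
  define \<eta> where "\<eta> = fls_subdegree (ev (euler g))"
  define C where "C = int (l choose 2)"
  let ?Q = "det (wronskian l \<alpha> \<beta>)"
  have A: "A \<in> carrier_mat l l" by (simp add: A_def wronskian_def)
  have x: "x \<in> carrier_vec l" by (simp add: x_def)
  have detA: "det A = ev ?Q" by (simp add: A_def eval_at.hom_det)
  have Q0: "ev ?Q \<noteq> 0" by (rule wronskian_nz[OF indep])
  have Ax: "(A *\<^sub>v x) $ i = (D ^^ i) F" if "i < l" for i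
    using that unfolding F_def D_iter_lincomb
    by (auto simp: A_def x_def wronskian_def scalar_prod_def D_iter_branch_monom lessThan_atLeast0
        algebra_simps intro!: sum.cong)
  have "det (replace_col A (A *\<^sub>v x) k)
      \<in> val_ge ((\<Sum>i<l. int i * \<eta>) + (\<Sum>j<l. if j = k then fls_subdegree F else 0))"
  proof (rule val_ge.det_mem)
    show "replace_col A (A *\<^sub>v x) k \<in> carrier_mat l l" using A by (simp add: replace_col_def)
    fix i j assume ij: "i < l" "j < l"
    have "(D ^^ i) F \<in> val_ge (int i * \<eta> + fls_subdegree F)"
      unfolding \<eta>_def by (rule D_iter_val_ge) (simp add: val_ge_def)
    moreover have "ev (cofac (\<alpha> j) (\<beta> j) i) \<in> val_ge (int i * \<eta>)"
      unfolding \<eta>_def by (rule cofac_val_ge)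
    ultimately show "replace_col A (A *\<^sub>v x) k $$ (i, j)
        \<in> val_ge (int i * \<eta> + (if j = k then fls_subdegree F else 0))"
      using ij A Ax[OF ij(1)] by (auto simp: replace_col_def A_def wronskian_def)
  qed
  moreover have "det (replace_col A (A *\<^sub>v x) k) = fls_const (c k) * ?f k * ev ?Q"
    using cramer_lemma_mat[OF A x k(1)] k(1) detA by (simp add: x_def)
  moreover have "fls_const (c k) * ?f k * ev ?Q \<noteq> 0"
    using k(2) Q0 by (simp add: fls_const_nonzero)
  ultimately have "C * \<eta> + fls_subdegree F \<le> fls_subdegree (fls_const (c k) * ?f k * ev ?Q)"
    using k(1) by (simp add: val_ge_def C_def sum_lessThan_choose_2 flip: sum_distrib_right)
  also have "\<dots> = int e * int (\<alpha> k) + s * int (\<beta> k) + fls_subdegree (ev ?Q)"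
    using k(2) Q0 by (simp add: fls_const_nonzero branch_monom_val mult.commute)
  finally have main: "C * \<eta> + fls_subdegree F
      \<le> int e * int (\<alpha> k) + s * int (\<beta> k) + fls_subdegree (ev ?Q)" .
  show ?thesis
  proof (cases "l choose 2 = 0")
    case True
    have "?Q \<in> bideg_le 0"
      using wronskian_bideg_le[of l \<alpha> \<beta>] by (simp only: True mult_0_right of_nat_0)
    then have "fls_subdegree (ev ?Q) \<le> 0" using Q0 by (rule ev_val_le_const)
    then show ?thesis using main by (simp only: C_def True of_nat_0 mult_zero_left mult_zero_right)
  next
    case False
    then have C1: "C \<ge> 1" unfolding C_def by linarith
    define N where "N = int e * (int d)\<^sup>2"
    have N: "0 \<le> N" "0 \<le> int e * int d" by (auto simp: N_def)
    have Q: "fls_subdegree (ev ?Q) \<le> 2 * N * C + N"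
      using ev_val_le[OF wronskian_bideg_le Q0]
      by (simp add: C_def N_def power2_eq_square algebra_simps)
    have "degree (pderiv g) \<le> d" using degree_g_le by (simp add: degree_pderiv)
    then have "- N \<le> fls_subdegree (ev (pderiv g))"
      using ev_val_ge ev_pderiv_nz by (auto simp: val_ge_def N_def)
    then have "s - N \<le> \<eta>"
      using ev_pderiv_nz \<Phi>_nz by (simp add: \<eta>_def ev_euler)
    then have "C * (s - N) \<le> C * \<eta>" using C1 by (intro mult_left_mono) auto
    moreover have "N \<le> N * C" using N C1 by (simp add: mult_le_cancel_left1)
    moreover have "0 \<le> (int e * int d) * C" "0 \<le> N * C" using N C1 by auto
    ultimately have "fls_subdegree F \<le> int e * int (\<alpha> k) + s * int (\<beta> k)
        + (8 * (N * C) + 2 * ((int e * int d) * C) - C * s)"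
      using main Q by (simp add: algebra_simps)
    then show ?thesis by (simp add: N_def C_def power2_eq_square algebra_simps)
  qed
qed

end

subsection \<open>Puiseux series as Laurent series in a root of the variable\<close>

definition of_fls :: "nat \<Rightarrow> 'b::zero fls \<Rightarrow> 'b pseries" where
  "of_fls e x q = (if \<exists>n. q = of_int n / of_nat e then fls_nth x \<lfloor>q * of_nat e\<rfloor> else 0)"

context
  fixes e :: nat
  assumes e_pos: "e > 0"
begin

lemma of_fls_grid [simp]: "of_fls e x (of_int n / of_nat e) = fls_nth x n"
  using e_pos by (auto simp: of_fls_def)

lemma of_fls_off_grid: "(\<And>n. q \<noteq> of_int n / of_nat e) \<Longrightarrow> of_fls e x q = 0"
  by (simp add: of_fls_def)

lemma of_fls_nonzeroE:
  assumes "of_fls e x q \<noteq> 0"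
  obtains n where "q = of_int n / of_nat e" "fls_nth x n \<noteq> 0"
  using assms of_fls_off_grid[of q x] of_fls_grid by metis

lemma grid_cases:
  obtains n where "q = (of_int n / of_nat e :: rat)" | "\<And>n. q \<noteq> of_int n / of_nat e"
  by blast

lemma of_fls_eqI:
  assumes "\<And>n. \<psi> (of_int n / of_nat e) = fls_nth x n"
    and "\<And>q. (\<And>n. q \<noteq> of_int n / of_nat e) \<Longrightarrow> \<psi> q = 0"
  shows "\<psi> = of_fls e x"
proof
  fix q
  show "\<psi> q = of_fls e x q"
    by (cases q rule: grid_cases) (simp_all add: assms of_fls_off_grid)
qed

lemma of_fls_eq_0_iff: "of_fls e x = (\<lambda>_. 0) \<longleftrightarrow> x = 0"
proof
  assume z: "of_fls e x = (\<lambda>_. 0)"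
  have "fls_nth x n = 0" for n using fun_cong[OF z, of "of_int n / of_nat e"] by simp
  then show "x = 0" by (intro fls_eqI) simp
qed (auto simp: of_fls_def)

lemma ex_of_fls_of_grid:
  assumes "\<forall>q. \<phi> q \<noteq> 0 \<longrightarrow> (\<exists>t::int. t \<ge> t0 \<and> q = of_int t / of_nat e)"
  shows "\<exists>x. \<phi> = of_fls e x"
proof -
  have z: "\<phi> (of_int n / of_nat e) = 0" if "n < t0" for n
    using assms that e_pos by fastforce
  have "\<phi> = of_fls e (Abs_fls (\<lambda>n. \<phi> (of_int n / of_nat e)))"
    using assms z by (intro of_fls_eqI) (auto simp: nth_Abs_fls_lower_bound[of t0])
  then show ?thesis by blast
qed

lemma ps_val_of_fls:
  assumes "x \<noteq> 0"
  shows "ps_val (of_fls e x) = ereal (real_of_rat (of_int (fls_subdegree x) / of_nat e))"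
  unfolding ps_val_def
proof (rule antisym)
  show "(INF q\<in>{q. of_fls e x q \<noteq> 0}. ereal (real_of_rat q))
      \<le> ereal (real_of_rat (of_int (fls_subdegree x) / of_nat e))"
    using assms by (intro INF_lower) (simp add: nth_fls_subdegree_nonzero)
  show "ereal (real_of_rat (of_int (fls_subdegree x) / of_nat e))
      \<le> (INF q\<in>{q. of_fls e x q \<noteq> 0}. ereal (real_of_rat q))"
  proof (rule INF_greatest)
    fix q assume "q \<in> {q. of_fls e x q \<noteq> 0}"
    then obtain n where n: "q = of_int n / of_nat e" "fls_nth x n \<noteq> 0"
      by (auto elim: of_fls_nonzeroE)
    then have "fls_subdegree x \<le> n" by (auto intro: fls_subdegree_leI)
    then show "ereal (real_of_rat (of_int (fls_subdegree x) / of_nat e)) \<le> ereal (real_of_rat q)"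
      using n(1) by (simp add: of_rat_less_eq divide_right_mono)
  qed
qed

lemma ps_val_of_fls_0: "ps_val (of_fls e (0 :: 'b::zero fls)) = \<infinity>"
proof -
  have "of_fls e (0 :: 'b fls) = (\<lambda>_. 0)" by (simp add: of_fls_eq_0_iff)
  then show ?thesis by (simp add: ps_val_def top_ereal_def)
qed

lemma fls_times_nth_support:
  "fls_nth (x * y) n = (\<Sum>i | fls_nth x i \<noteq> 0 \<and> fls_nth y (n - i) \<noteq> 0. fls_nth x i * fls_nth y (n - i))"
  for x y :: "'b::comm_ring_1 fls"
  unfolding fls_times_nth(2)
proof (rule sum.mono_neutral_right)
  show "{i. fls_nth x i \<noteq> 0 \<and> fls_nth y (n - i) \<noteq> 0} \<subseteq> {fls_subdegree x..n - fls_subdegree y}"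
    using fls_subdegree_leI[of x] fls_subdegree_leI[of y] by fastforce
qed auto

lemma ps_mult_of_fls: "ps_mult (of_fls e x) (of_fls e y) = of_fls e (x * y)"
proof (rule of_fls_eqI)
  fix n
  let ?r = "\<lambda>i::int. of_int i / of_nat e :: rat"
  have sub: "?r n - ?r i = ?r (n - i)" for i by (simp add: diff_divide_distrib)
  have set: "{s. of_fls e x s \<noteq> 0 \<and> of_fls e y (?r n - s) \<noteq> 0}
      = ?r ` {i. fls_nth x i \<noteq> 0 \<and> fls_nth y (n - i) \<noteq> 0}"
  proof (intro equalityI subsetI)
    fix s assume s: "s \<in> {s. of_fls e x s \<noteq> 0 \<and> of_fls e y (?r n - s) \<noteq> 0}"
    then obtain i where "s = ?r i" "fls_nth x i \<noteq> 0" by (auto elim: of_fls_nonzeroE)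
    then show "s \<in> ?r ` {i. fls_nth x i \<noteq> 0 \<and> fls_nth y (n - i) \<noteq> 0}"
      using s sub[of i] of_fls_grid[of y "n - i"] by auto
  next
    fix s assume "s \<in> ?r ` {i. fls_nth x i \<noteq> 0 \<and> fls_nth y (n - i) \<noteq> 0}"
    then show "s \<in> {s. of_fls e x s \<noteq> 0 \<and> of_fls e y (?r n - s) \<noteq> 0}"
      using sub of_fls_grid[of y] by (auto simp del: of_int_diff)
  qed
  have inj: "inj_on ?r A" for A using e_pos by (auto intro!: inj_onI)
  show "ps_mult (of_fls e x) (of_fls e y) (?r n) = fls_nth (x * y) n"
    unfolding ps_mult_def set sum.reindex[OF inj] fls_times_nth_support
    by (simp add: sub del: of_int_diff)
next
  fix q :: rat assume q: "\<And>n. q \<noteq> of_int n / of_nat e"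
  have "{s. of_fls e x s \<noteq> 0 \<and> of_fls e y (q - s) \<noteq> 0} = {}"
  proof safe
    fix s assume "of_fls e x s \<noteq> 0" "of_fls e y (q - s) \<noteq> 0"
    then obtain i j where "s = of_int i / of_nat e" "q - s = of_int j / of_nat e"
      by (metis of_fls_nonzeroE)
    then have "q = of_int (i + j) / of_nat e" by (simp add: add_divide_distrib algebra_simps)
    then show "s \<in> {}" using q by blast
  qed
  then show "ps_mult (of_fls e x) (of_fls e y) q = 0" by (simp only: ps_mult_def sum.empty)
qed

lemma of_fls_const: "ps_const c = of_fls e (fls_const c)"
  using e_pos by (intro of_fls_eqI) (auto simp: ps_const_def, metis div_0 of_int_0)

lemma ps_pow_of_fls: "ps_pow (of_fls e x) n = of_fls e (x ^ n)"
  by (induction n) (simp_all add: ps_mult_of_fls of_fls_const)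

lemma of_nat_eq_grid: "of_int k / of_nat e = (of_nat n :: rat) \<longleftrightarrow> k = int (e * n)"
proof -
  have "of_int k / of_nat e = (of_nat n :: rat) \<longleftrightarrow> of_int k = (of_int (int (e * n)) :: rat)"
    using e_pos by (simp add: field_simps)
  then show ?thesis by (simp only: of_int_eq_iff)
qed

lemma ps_Xpow_of_fls: "ps_Xpow n = of_fls e (fls_X ^ (e * n))"
  by (intro of_fls_eqI) (auto simp: ps_Xpow_def of_nat_eq_grid, metis of_nat_eq_grid)

lemma ps_of_poly_of_fls: "ps_of_poly p = of_fls e (fls_of_poly e p)"
proof (rule of_fls_eqI)
  fix k
  show "ps_of_poly p (of_int k / of_nat e) = fls_nth (fls_of_poly e p) k"
  proof (cases "\<exists>n. k = int (e * n)")
    case True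
    then obtain n where n: "k = int (e * n)" by blast
    then have "of_int k / of_nat e = (of_nat n :: rat)" by (simp only: of_nat_eq_grid)
    then show ?thesis using n e_pos by (auto simp: ps_of_poly_def fls_of_poly_nth)
  next
    case False
    then have "\<not> (k \<ge> 0 \<and> int e dvd k)"
      by (metis dvdE e_pos nonneg_int_cases not_less of_nat_0_less_iff of_nat_mult zero_le_mult_iff)
    then show ?thesis using False e_pos by (auto simp: ps_of_poly_def fls_of_poly_nth of_nat_eq_grid)
  qed
next
  fix q :: rat assume q: "\<And>n. q \<noteq> of_int n / of_nat e"
  then have "q \<noteq> of_nat n" for n by (metis of_nat_eq_grid)
  then show "ps_of_poly p q = 0" by (simp add: ps_of_poly_def)
qed

lemma of_fls_add: "of_fls e (x + y) q = of_fls e x q + of_fls e y q"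
  for x y :: "'b::field fls"
  by (simp add: of_fls_def)

lemma of_fls_sum: "of_fls e (\<Sum>j\<in>J. f j) q = (\<Sum>j\<in>J. of_fls e (f j) q)"
  for f :: "'c \<Rightarrow> 'b::field fls"
proof -
  have "of_fls e (0 :: 'b fls) q = 0" by (simp add: of_fls_def)
  then show ?thesis by (induction J rule: infinite_finite_induct) (simp_all add: of_fls_add)
qed

lemma of_fls_const_mult: "of_fls e (fls_const c * x) q = c * of_fls e x q"
  for x :: "'b::field fls"
  by (simp add: of_fls_def)

lemma ps_eval_of_fls: "ps_eval g (of_fls e \<Phi>) = of_fls e (eval_at e \<Phi> g)"
  by (rule ext)
    (simp add: ps_eval_def ps_of_poly_of_fls ps_pow_of_fls ps_mult_of_fls eval_at_altdef of_fls_sum)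

end

theorem theorem4:
  fixes g :: "'a::field_char_0 poly poly"
    and \<phi> :: "'a alg_closure pseries"
    and v :: rat and d l :: nat
    and c :: "nat \<Rightarrow> 'a alg_closure" and \<alpha> \<beta> :: "nat \<Rightarrow> nat"
  assumes "irreducible g"
    and "total_degree g = d"
    and "pderiv g \<noteq> 0"
    and "is_puiseux \<phi>"
    and "ps_eval g \<phi> = (\<lambda>_. 0)"
    and "ps_val \<phi> = ereal (real_of_rat v)"
    and "l \<ge> 1"
    and "\<forall>j<l. c j \<noteq> 0"
    and "\<forall>i<l. \<forall>j<l. i \<noteq> j \<longrightarrow> (\<alpha> i, \<beta> i) \<noteq> (\<alpha> j, \<beta> j)"
    and "ps_lin_indep l (\<lambda>j. ps_mult (ps_Xpow (\<alpha> j)) (ps_pow \<phi> (\<beta> j)))"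
  shows "ps_val (\<lambda>q. \<Sum>j<l. c j * ps_mult (ps_Xpow (\<alpha> j)) (ps_pow \<phi> (\<beta> j)) q)
           \<le> ereal (real_of_rat
                (Min ((\<lambda>j. of_nat (\<alpha> j) + v * of_nat (\<beta> j)) ` {..<l})
                 + (2 * of_nat d * (4 * of_nat d + 1) - v) * of_nat (l choose 2)))"
proof -
  obtain e t0 where e: "e > 0"
    and "\<forall>q. \<phi> q \<noteq> 0 \<longrightarrow> (\<exists>t::int. t \<ge> t0 \<and> q = of_int t / of_nat e)"
    using assms(4) unfolding is_puiseux_def by blast
  then obtain \<Phi> where \<phi>: "\<phi> = of_fls e \<Phi>" using ex_of_fls_of_grid by blast
  have \<Phi>0: "\<Phi> \<noteq> 0" using assms(6) by (auto simp: \<phi> ps_val_of_fls_0[OF e])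
  then have "v = of_int (fls_subdegree \<Phi>) / of_nat e"
    using assms(6) by (simp add: \<phi> ps_val_of_fls[OF e])
  then have v: "of_int (fls_subdegree \<Phi>) = of_nat e * v" using e by simp
  interpret laurent_root g e d \<Phi>
  proof
    show "degree g > 0" using assms(3) by (auto simp: pderiv_eq_0_iff)
    show "g \<in> bideg_le (int d)" using total_degree_bideg_le assms(2) by blast
    show "eval_at e \<Phi> g = 0" using assms(5) by (simp add: \<phi> ps_eval_of_fls[OF e] of_fls_eq_0_iff[OF e])
  qed (use e assms(1) \<Phi>0 in auto)
  let ?f = "\<lambda>j. branch_monom (\<alpha> j) (\<beta> j)"
  have f: "ps_mult (ps_Xpow (\<alpha> j)) (ps_pow \<phi> (\<beta> j)) = of_fls e (?f j)" for j
    by (simp add: \<phi> ps_Xpow_of_fls[OF e] ps_pow_of_fls[OF e] ps_mult_of_fls[OF e] branch_monom_def)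
  have comb: "(\<lambda>q. \<Sum>j<l. a j * of_fls e (?f j) q) = of_fls e (\<Sum>j<l. fls_const (a j) * ?f j)" for a
    by (rule ext) (simp add: of_fls_sum[OF e] of_fls_const_mult[OF e])
  have indep: "\<forall>j<l. a j = 0" if "(\<Sum>j<l. fls_const (a j) * ?f j) = 0" for a
  proof -
    have "(\<lambda>q. \<Sum>j<l. a j * of_fls e (?f j) q) = (\<lambda>_. 0)"
      unfolding comb using that of_fls_eq_0_iff[OF e] by blast
    then show ?thesis using assms(10) unfolding ps_lin_indep_def f by metis
  qed
  define F where "F = (\<Sum>j<l. fls_const (c j) * ?f j)"
  have "F \<noteq> 0" using indep[of c] assms(7,8) unfolding F_def by fastforce
  have "Min ((\<lambda>j. of_nat (\<alpha> j) + v * of_nat (\<beta> j)) ` {..<l})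
      \<in> (\<lambda>j. of_nat (\<alpha> j) + v * of_nat (\<beta> j)) ` {..<l}"
    using assms(7) by (intro Min_in) (auto simp: lessThan_empty_iff)
  then obtain k where k: "k < l"
    "Min ((\<lambda>j. of_nat (\<alpha> j) + v * of_nat (\<beta> j)) ` {..<l}) = of_nat (\<alpha> k) + v * of_nat (\<beta> k)"
    by auto
  have "fls_subdegree F \<le> int e * int (\<alpha> k) + fls_subdegree \<Phi> * int (\<beta> k)
      + (int e * (2 * int d * (4 * int d + 1)) - fls_subdegree \<Phi>) * int (l choose 2)"
    unfolding F_def using indep k(1) assms(8) by (intro lincomb_val_le) auto
  then have "(of_int (fls_subdegree F) :: rat) \<le> of_int (int e * int (\<alpha> k) + fls_subdegree \<Phi> * int (\<beta> k)
      + (int e * (2 * int d * (4 * int d + 1)) - fls_subdegree \<Phi>) * int (l choose 2))"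
    by (simp only: of_int_le_iff)
  also have "\<dots> = of_nat e * (of_nat (\<alpha> k) + v * of_nat (\<beta> k)
      + (2 * of_nat d * (4 * of_nat d + 1) - v) * of_nat (l choose 2))"
    by (simp add: v algebra_simps)
  finally have "of_int (fls_subdegree F) / of_nat e \<le> of_nat (\<alpha> k) + v * of_nat (\<beta> k)
      + (2 * of_nat d * (4 * of_nat d + 1) - v) * of_nat (l choose 2)"
    using e by (simp add: divide_le_eq mult.commute)
  then show ?thesis
    unfolding f comb F_def[symmetric] ps_val_of_fls[OF e \<open>F \<noteq> 0\<close>] k(2)
    by (simp only: ereal_less_eq of_rat_less_eq)
qed

end
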